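(* Every deterministic assignment satisfying favoring-eagerness-for-remaining-items (FERI) with respect to a preference profile $R$ also satisfies Pareto-efficiency (PE) with respect to $R$. The converse fails: there exist an assignment problem, a preference profile, and a deterministic assignment that satisfies PE but not FERI.
   Context: Setting. An assignment problem has a set $N=\{1,\dots,n\}$ of agents and a set $M$ of $n$ items (one unit each). A preference profile $R=(\succ_j)_{j\in N}$ gives each agent $j$ a strict linear order $\succ_j$ on $M$. For nonempty $S\subseteq M$, $\mathrm{top}(j,S)$ is the $\succ_j$-best item of $S$. A deterministic assignment is a bijection $A:N\to M$. FERI. For a deterministic assignment $A$ define recursively for $r=1,2,\dots$: $T_{A,r}=\{o\in M: o=\mathrm{top}(j,M\setminus\bigcup_{r'<r}T_{A,r'})\text{ for some }j\in N\text{ with }A(j)\notin\bigcup_{r'<r}T_{A,r'}\}$. $A$ satisfies FERI if for every $r\ge 1$ and every $o\in T_{A,r}$, $o=\mathrm{top}(A^{-1}(o),M\setminus\bigcup_{r'<r}T_{A,r'})$. PE. $A$ satisfies PE if there do not exist a deterministic assignment $A'$ and a nonempty $N'\subseteq N$ such that $A'(j)\succ_jA(j)$ for all $j\in N'$ and $A'(k)=A(k)$ for all $k\in N\setminus N'$. *)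

theory Defs
  imports Main
begin

text \<open>
  Agents are the numbers \<open>1..n\<close>; items are the elements of a set \<open>M\<close> with \<open>n\<close> elements.
  A preference profile maps each agent \<open>j\<close> to a relation on \<open>M\<close>, where \<open>(x, y) \<in> R j\<close>
  means that \<open>j\<close> strictly prefers \<open>x\<close> to \<open>y\<close>.
  Profiles and assignments are total functions, but only their values on \<open>{1..n}\<close> matter.
\<close>

type_synonym 'a profile = "nat \<Rightarrow> 'a rel"

definition assignment_problem :: "nat \<Rightarrow> 'a set \<Rightarrow> bool" where
  "assignment_problem n M \<longleftrightarrow> finite M \<and> card M = n"

text \<open>The inclusion in \<open>M \<times> M\<close> is stated because \<^const>\<open>strict_linear_order_on\<close> does not imply it.\<close>

definition preference_profile :: "nat \<Rightarrow> 'a set \<Rightarrow> 'a profile \<Rightarrow> bool" where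
  "preference_profile n M R \<longleftrightarrow>
    (\<forall>j\<in>{1..n}. R j \<subseteq> M \<times> M \<and> strict_linear_order_on M (R j))"

definition deterministic_assignment :: "nat \<Rightarrow> 'a set \<Rightarrow> (nat \<Rightarrow> 'a) \<Rightarrow> bool" where
  "deterministic_assignment n M A \<longleftrightarrow> bij_betw A {1..n} M"

text \<open>Meaningful only for nonempty \<open>S \<subseteq> M\<close>, which is the only case that matters below.\<close>

definition top_item :: "'a profile \<Rightarrow> nat \<Rightarrow> 'a set \<Rightarrow> 'a" where
  "top_item R j S = (THE x. x \<in> S \<and> (\<forall>y\<in>S - {x}. (x, y) \<in> R j))"

text \<open>Rounds are numbered from 1; the value at \<open>r = 0\<close> is never used.\<close>

fun feri_round :: "nat \<Rightarrow> 'a set \<Rightarrow> 'a profile \<Rightarrow> (nat \<Rightarrow> 'a) \<Rightarrow> nat \<Rightarrow> 'a set" where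
  "feri_round n M R A r =
    (let U = (\<Union>r'\<in>{1..<r}. feri_round n M R A r')
     in {x \<in> M. \<exists>j\<in>{1..n}. A j \<notin> U \<and> x = top_item R j (M - U)})"

declare feri_round.simps [simp del]

definition FERI :: "nat \<Rightarrow> 'a set \<Rightarrow> 'a profile \<Rightarrow> (nat \<Rightarrow> 'a) \<Rightarrow> bool" where
  "FERI n M R A \<longleftrightarrow>
    (\<forall>r\<ge>1. \<forall>x\<in>feri_round n M R A r.
      x = top_item R (inv_into {1..n} A x) (M - (\<Union>r'\<in>{1..<r}. feri_round n M R A r')))"

definition PE :: "nat \<Rightarrow> 'a set \<Rightarrow> 'a profile \<Rightarrow> (nat \<Rightarrow> 'a) \<Rightarrow> bool" where
  "PE n M R A \<longleftrightarrow>
    \<not> (\<exists>A' N'. deterministic_assignment n M A' \<and> N' \<noteq> {} \<and> N' \<subseteq> {1..n} \<and>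
         (\<forall>j\<in>N'. (A' j, A j) \<in> R j) \<and> (\<forall>k\<in>{1..n} - N'. A' k = A k))"

end

theory Submission
  imports Defs
begin

text \<open>
  For the implication, suppose every agent of \<open>N'\<close> strictly gains by moving from a FERI assignment
  \<open>A\<close> to \<open>A'\<close>. By induction on rounds, the owner of an item taken in round \<open>r\<close> keeps it under \<open>A'\<close>:
  the item is its owner's favourite among the remaining ones, so a better item would have been
  taken earlier, and its owner keeps that item by induction. On the other hand, as long as some agent
  is unserved, each round takes at least one new item, so by finiteness every agent is served.

  For the converse, serial dictatorship 1, 2, 3 is Pareto-efficient, but if agents 1 and 2
  both like item 1 best and agent 3 likes item 2 best, giving item 2 to agent 2 violates FERI.
\<close>

definition feri_taken :: "nat \<Rightarrow> 'a set \<Rightarrow> 'a profile \<Rightarrow> (nat \<Rightarrow> 'a) \<Rightarrow> nat \<Rightarrow> 'a set" where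
  "feri_taken n M R A r = (\<Union>r'\<in>{1..<r}. feri_round n M R A r')"

text \<open>Hides the recursion of \<open>feri_round\<close> behind \<open>feri_taken\<close>, so
  that it can be used for rewriting without looping.\<close>

lemma mem_feri_round_iff:
  "x \<in> feri_round n M R A r \<longleftrightarrow>
    x \<in> M \<and> (\<exists>j\<in>{1..n}. A j \<notin> feri_taken n M R A r \<and> x = top_item R j (M - feri_taken n M R A r))"
  unfolding feri_taken_def by (subst feri_round.simps) (auto simp: Let_def)

lemma top_item_eqI:
  assumes "irrefl (R j)" "trans (R j)" "x \<in> S" "\<And>y. y \<in> S \<Longrightarrow> y \<noteq> x \<Longrightarrow> (x, y) \<in> R j"
  shows "top_item R j S = x"
  unfolding top_item_def
  by (rule the_equality) (use assms in \<open>auto simp: irrefl_def dest: transD\<close>)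

lemma top_item_greatest:
  assumes "strict_linear_order_on M (R j)" "S \<subseteq> M" "finite S" "S \<noteq> {}"
  shows "top_item R j S \<in> S" "\<And>y. y \<in> S \<Longrightarrow> y \<noteq> top_item R j S \<Longrightarrow> (top_item R j S, y) \<in> R j"
proof -
  have slo: "irrefl (R j)" "trans (R j)" "total_on M (R j)"
    using assms(1) by (auto simp: strict_linear_order_on_def)
  obtain x where x: "x \<in> S" "\<And>y. y \<in> S \<Longrightarrow> (y, x) \<notin> R j"
  proof -
    have "acyclic (R j)"
      using slo(1,2) by (simp add: acyclic_irrefl)
    \<comment> \<open>Pairs run from better to worse, so a minimal element is an unbeaten item;
      totality then makes it the best.\<close>
    then have "wf (R j \<inter> S \<times> S)"
      using assms(3) by (intro finite_acyclic_wf) (auto intro: acyclic_subset)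
    then show thesis
      using that assms(4) by (elim wfE_min') blast+
  qed
  then have max: "(x, y) \<in> R j" if "y \<in> S" "y \<noteq> x" for y
    using that x slo(3) assms(2) by (auto simp: total_on_def)
  have "top_item R j S = x"
    using slo x(1) max by (intro top_item_eqI) auto
  then show "top_item R j S \<in> S"
    "\<And>y. y \<in> S \<Longrightarrow> y \<noteq> top_item R j S \<Longrightarrow> (top_item R j S, y) \<in> R j"
    using x(1) max by auto
qed

lemma preference_profileD:
  assumes "preference_profile n M R" "j \<in> {1..n}"
  shows "strict_linear_order_on M (R j)"
  using assms by (simp add: preference_profile_def)

text \<open>If \<open>A j\<close> were never taken, agent \<open>j\<close> would stay active forever
  and its favourite remaining item would be taken in every round: infinitely many distinct items of
  the finite set \<open>M\<close>.\<close>

lemma feri_round_covers: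
  assumes "finite M" "preference_profile n M R" "deterministic_assignment n M A" "j \<in> {1..n}"
  shows "\<exists>r\<ge>1. A j \<in> feri_round n M R A r"
proof (rule ccontr)
  assume never: "\<not> ?thesis"
  define U where "U = feri_taken n M R A"
  define f where "f r = top_item R j (M - U r)" for r
  have Aj: "A j \<in> M - U r" for r
    using never assms(3,4)
    by (auto simp: U_def feri_taken_def deterministic_assignment_def bij_betw_def)
  have f_mem: "f r \<in> M - U r" for r
    unfolding f_def using assms Aj
    by (intro top_item_greatest(1) preference_profileD) auto
  then have f_round: "f r \<in> feri_round n M R A r" for r
    unfolding mem_feri_round_iff using Aj assms(4) by (auto simp only: f_def U_def)
  \<comment> \<open>\<open>f r\<close> is taken in round \<open>r\<close>, hence lies in
    \<open>U s\<close>, which \<open>f s\<close> avoids. Since \<open>U s\<close> collects rounds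
    from 1 on, \<open>r = 0\<close> is excluded.\<close>
  have "f r \<noteq> f s" if "1 \<le> r" "r < s" for r s
    using f_mem[of s] f_round[of r] that by (auto simp: U_def feri_taken_def)
  then have "inj_on f {1..}"
    by (intro linorder_inj_onI) auto
  moreover have "finite (f ` {1..})"
    using f_mem assms(1) by (auto intro: finite_subset)
  ultimately show False
    using infinite_Ici finite_imageD by blast
qed

text \<open>\<open>weak\<close> covers agents inside and outside the improving coalition alike, so
  the induction hypothesis applies to whoever owns an earlier item.\<close>

lemma FERI_owner_keeps_item:
  assumes "finite M" and prof: "preference_profile n M R"
    and A: "deterministic_assignment n M A" and "FERI n M R A"
    and A': "deterministic_assignment n M A'"
    and weak: "\<And>k. k \<in> {1..n} \<Longrightarrow> A' k = A k \<or> (A' k, A k) \<in> R k"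
  shows "\<lbrakk>1 \<le> r; j \<in> {1..n}; A j \<in> feri_round n M R A r\<rbrakk> \<Longrightarrow> A' j = A j"
proof (induction r arbitrary: j rule: less_induct)
  case (less r)
  define U where "U = feri_taken n M R A r"
  have inj: "inj_on A {1..n}" "inj_on A' {1..n}" and im: "A ` {1..n} = M" "A' ` {1..n} = M"
    using A A' by (auto simp: deterministic_assignment_def bij_betw_def)
  have slo: "strict_linear_order_on M (R j)"
    using prof less.prems(2) by (rule preference_profileD)
  have top: "A j = top_item R j (M - U)"
    using assms(4) less.prems inv_into_f_f[OF inj(1) less.prems(2)]
    unfolding FERI_def U_def feri_taken_def by metis
  \<comment> \<open>The agent that requests \<open>A j\<close> in round \<open>r\<close> is itself
    unserved, so items remain and \<open>top_item\<close> is meaningful.\<close>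
  obtain i where "i \<in> {1..n}" "A i \<notin> U"
    using less.prems(3) by (auto simp: mem_feri_round_iff U_def)
  then have ne: "M - U \<noteq> {}"
    using im(1) by blast
  have Aj: "A j \<notin> U"
    using top_item_greatest(1)[of M R j "M - U"] slo ne assms(1) top by auto
  show ?case
  proof (rule ccontr)
    assume neq: "A' j \<noteq> A j"
    then have pref: "(A' j, A j) \<in> R j"
      using weak less.prems(2) by blast
    have "A' j \<in> U"
    proof (rule ccontr)
      assume "A' j \<notin> U"
      then have "A' j \<in> M - U"
        using im(2) less.prems(2) by blast
      then have "(A j, A' j) \<in> R j"
        using top_item_greatest(2)[of M R j "M - U" "A' j"] slo ne assms(1) top neq by auto
      then show False
        using pref slo by (meson irreflD strict_linear_order_on_def transD)
    qed
    then obtain s where s: "1 \<le> s" "s < r" "A' j \<in> feri_round n M R A s"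
      by (auto simp: U_def feri_taken_def)
    \<comment> \<open>The owner \<open>k\<close> of \<open>A' j\<close> under \<open>A\<close> keeps
      it by induction, so \<open>A'\<close> would give one item to both \<open>k\<close> and
      \<open>j\<close>.\<close>
    obtain k where k: "k \<in> {1..n}" "A k = A' j"
      using im less.prems(2) by (metis imageE imageI)
    then have "A' k = A' j"
      using less.IH[of s k] s by simp
    then have "k = j"
      using inj(2) k(1) less.prems(2) by (auto dest: inj_onD)
    with k neq show False by simp
  qed
qed

lemma FERI_imp_PE:
  assumes "finite M" "preference_profile n M R" "deterministic_assignment n M A" "FERI n M R A"
  shows "PE n M R A"
  unfolding PE_def
proof (intro notI, elim exE conjE)
  fix A' N'
  assume A': "deterministic_assignment n M A'" and N': "N' \<noteq> {}" "N' \<subseteq> {1..n}"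
    and better: "\<forall>j\<in>N'. (A' j, A j) \<in> R j" and same: "\<forall>k\<in>{1..n} - N'. A' k = A k"
  obtain j where j: "j \<in> N'" "j \<in> {1..n}"
    using N' by blast
  obtain r where "1 \<le> r" "A j \<in> feri_round n M R A r"
    using feri_round_covers[OF assms(1-3) j(2)] by blast
  then have "A' j = A j"
    using better same j(2) by (intro FERI_owner_keeps_item[OF assms A']) auto
  then have "(A j, A j) \<in> R j"
    using better j(1) by metis
  then show False
    using preference_profileD[OF assms(2) j(2)]
    by (simp add: strict_linear_order_on_def irrefl_def)
qed

lemma PE_not_FERI_witness:
  fixes M :: "nat set" and R :: "nat profile"
  defines "M \<equiv> {1, 2, 3}"
    and "R \<equiv> \<lambda>j. if j = 3 then {(2, 1), (2, 3), (1, 3)} else {(1, 2), (1, 3), (2, 3)}"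
  shows "assignment_problem 3 M" "preference_profile 3 M R"
    "deterministic_assignment 3 M id" "PE 3 M R id" "\<not> FERI 3 M R id"
proof -
  have agents: "{1..3} = {1, 2, 3 :: nat}"
    by auto
  show "assignment_problem 3 M"
    by (simp add: assignment_problem_def M_def)
  show "preference_profile 3 M R"
    by (auto simp: preference_profile_def M_def R_def strict_linear_order_on_def irrefl_def
        total_on_def intro!: transI)
  show "deterministic_assignment 3 M id"
    unfolding deterministic_assignment_def M_def agents by (rule bij_betw_id)
  show "PE 3 M R id"
    unfolding PE_def
  proof (intro notI, elim exE conjE)
    fix A' N'
    assume A': "deterministic_assignment 3 M A'" and N': "N' \<noteq> {}" "N' \<subseteq> {1..3}"
      and better: "\<forall>j\<in>N'. (A' j, id j) \<in> R j" and same: "\<forall>k\<in>{1..3} - N'. A' k = id k"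
    have inj: "A' 1 \<noteq> A' 2" "A' 1 \<noteq> A' 3" "A' 2 \<noteq> A' 3"
      using A' unfolding deterministic_assignment_def bij_betw_def agents by (auto simp: inj_on_def)
    \<comment> \<open>In order of dictatorship, every item that an agent prefers to its own is
      already held by an earlier agent.\<close>
    have "1 \<notin> N'"
      using better by (auto simp: R_def)
    moreover from this have "A' 1 = 1"
      using same by (simp add: agents)
    moreover from this have "2 \<notin> N'"
      using better inj by (auto simp: R_def)
    moreover from this have "A' 2 = 2"
      using same by (simp add: agents)
    moreover from calculation have "3 \<notin> N'"
      using better inj by (auto simp: R_def)
    ultimately show False
      using N' unfolding agents by auto
  qed
  have tops: "top_item R 2 M = 1" "top_item R 3 M = 2"
    by (rule top_item_eqI; auto simp: R_def M_def irrefl_def intro!: transI)+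
  \<comment> \<open>Agent 3 requests item 2 in round 1, but its owner, agent 2, ranks item 1
    first.\<close>
  have "2 \<in> feri_round 3 M R id 1"
    using tops(2) by (auto simp: mem_feri_round_iff feri_taken_def M_def intro!: bexI[of _ 3])
  moreover have "inv_into {1..3} id (2 :: nat) = 2"
    by (rule inv_into_f_eq) auto
  ultimately show "\<not> FERI 3 M R id"
    using tops(1) by (force simp: FERI_def)
qed

theorem proposition2:
  shows "(\<forall>n (M :: 'a set) R A.
            assignment_problem n M \<and> preference_profile n M R \<and>
            deterministic_assignment n M A \<and> FERI n M R A \<longrightarrow> PE n M R A) \<and>
         (\<exists>n (M :: nat set) R A.
            assignment_problem n M \<and> preference_profile n M R \<and>
            deterministic_assignment n M A \<and> PE n M R A \<and> \<not> FERI n M R A)"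
proof (intro conjI allI impI)
  show "PE n M R A" if "assignment_problem n M \<and> preference_profile n M R \<and>
    deterministic_assignment n M A \<and> FERI n M R A" for n and M :: "'a set" and R A
    using that FERI_imp_PE by (auto simp: assignment_problem_def)
qed (rule exI conjI PE_not_FERI_witness)+

end
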